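(* The Petersen graph is determined by its adjacency spectrum; that is, every finite simple undirected graph whose adjacency matrix has the same multiset of eigenvalues as that of the Petersen graph is isomorphic to the Petersen graph.
   Context: The Petersen graph is the complement of the line graph of the complete graph $K_5$. *)

theory Defs
  imports
    "Graph_Theory.Graph_Theory"
    "Jordan_Normal_Form.Char_Poly"
begin

text \<open>
  A finite simple undirected graph is a \<^locale>\<open>pair_graph\<close>: each edge \<open>uv\<close> is represented by
  the two arcs \<open>(u, v)\<close> and \<open>(v, u)\<close>, and there are no loops.
\<close>

definition complete_graph :: "'a set \<Rightarrow> 'a pair_pre_digraph" where
  "complete_graph V = \<lparr> pverts = V, parcs = {(u, v). u \<in> V \<and> v \<in> V \<and> u \<noteq> v} \<rparr>"

definition graph_edges :: "'a pair_pre_digraph \<Rightarrow> 'a set set" where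
  "graph_edges G = {{u, v} | u v. (u, v) \<in> parcs G}"

definition line_graph :: "'a pair_pre_digraph \<Rightarrow> 'a set pair_pre_digraph" where
  "line_graph G = \<lparr> pverts = graph_edges G,
     parcs = {(e, f). e \<in> graph_edges G \<and> f \<in> graph_edges G \<and> e \<noteq> f \<and> e \<inter> f \<noteq> {}} \<rparr>"

definition complement_graph :: "'a pair_pre_digraph \<Rightarrow> 'a pair_pre_digraph" where
  "complement_graph G = \<lparr> pverts = pverts G,
     parcs = {(u, v). u \<in> pverts G \<and> v \<in> pverts G \<and> u \<noteq> v \<and> (u, v) \<notin> parcs G} \<rparr>"

definition petersen_graph :: "nat set pair_pre_digraph" where
  "petersen_graph = complement_graph (line_graph (complete_graph {..<5}))"

definition adjacency_matrix :: "'a list \<Rightarrow> 'a pair_pre_digraph \<Rightarrow> complex mat" where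
  "adjacency_matrix vs G =
     mat (length vs) (length vs) (\<lambda>(i, j). if (vs ! i, vs ! j) \<in> parcs G then 1 else 0)"

text \<open>
  The multiset of eigenvalues, counted with multiplicity. Working over the complex numbers ensures
  that the characteristic polynomial splits, so no eigenvalue can be missing. The choice of the
  vertex enumeration is immaterial by the lemma \<open>adjacency_spectrum_eq\<close> below.
\<close>

definition adjacency_spectrum :: "'a pair_pre_digraph \<Rightarrow> complex multiset" where
  "adjacency_spectrum G =
     proots (char_poly (adjacency_matrix (SOME vs. distinct vs \<and> set vs = pverts G) G))"

lemma complete_digraph_complete_graph:
  assumes "finite V"
  shows "complete_digraph (card V) (with_proj (complete_graph V))"
  using assms unfolding complete_digraph_pair_def by (simp add: complete_graph_def)

lemma pair_graph_petersen_graph: "pair_graph petersen_graph"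
proof -
  have "pverts petersen_graph \<subseteq> Pow {..<5}"
    by (auto simp: petersen_graph_def complement_graph_def line_graph_def graph_edges_def
        complete_graph_def)
  then have fin: "finite (pverts petersen_graph)"
    by (rule finite_subset) simp
  have sub: "parcs petersen_graph \<subseteq> pverts petersen_graph \<times> pverts petersen_graph"
    by (auto simp: petersen_graph_def complement_graph_def)
  then have fin': "finite (parcs petersen_graph)"
    by (rule finite_subset) (simp add: fin)
  have sym: "symmetric (with_proj petersen_graph)"
    by (auto simp: symmetric_def petersen_graph_def complement_graph_def line_graph_def intro!: symI)
  show ?thesis
  proof
    show "fst e \<in> pverts petersen_graph" "snd e \<in> pverts petersen_graph"
      if "e \<in> parcs petersen_graph" for e
      using that sub by (cases e; auto)+
    show "fst e \<noteq> snd e" if "e \<in> parcs petersen_graph" for e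
      using that by (auto simp: petersen_graph_def complement_graph_def)
  qed (fact fin fin' sym)+
qed

lemma similar_adjacency_matrix:
  assumes "distinct vs" "distinct ws" "set vs = set ws"
  shows "similar_mat (adjacency_matrix vs G) (adjacency_matrix ws G)"
proof -
  define n where "n = length ws"
  have "mset vs = mset ws"
    using assms by (simp add: set_eq_iff_mset_eq_distinct)
  then obtain p where p: "p permutes {..<n}" and vs: "permute_list p ws = vs"
    unfolding n_def by (rule mset_eq_permutation)
  have len: "length vs = n"
    using vs by (auto simp: n_def)
  have nth: "vs ! i = ws ! p i" if "i < n" for i
    using that p vs by (metis n_def permute_list_nth)
  have p_less: "p i < n" if "i < n" for i
    using that permutes_in_image[OF p, of i] by simp
  have p_inj: "p i = p j \<longleftrightarrow> i = j" for i j
    using permutes_inj[OF p] by (auto simp: inj_def)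
  define P where "P = mat n n (\<lambda>(i, j). if j = p i then 1 else 0 :: complex)"
  define Q where "Q = mat n n (\<lambda>(i, j). if i = p j then 1 else 0 :: complex)"
  define A where "A = adjacency_matrix ws G"
  have A: "A \<in> carrier_mat n n" and P: "P \<in> carrier_mat n n" and Q: "Q \<in> carrier_mat n n"
    by (auto simp: A_def adjacency_matrix_def P_def Q_def n_def)
  have PM: "P * M = mat n n (\<lambda>(i, j). M $$ (p i, j))" if "M \<in> carrier_mat n n" for M
  proof (rule eq_matI)
    fix i j assume "i < dim_row (mat n n (\<lambda>(i, j). M $$ (p i, j)))"
      and "j < dim_col (mat n n (\<lambda>(i, j). M $$ (p i, j)))"
    then show "(P * M) $$ (i, j) = mat n n (\<lambda>(i, j). M $$ (p i, j)) $$ (i, j)"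
      using that by (auto simp: P_def scalar_prod_def if_distrib[of "\<lambda>x. x * _"] p_less cong: if_cong)
  qed (use that P in auto)
  have MQ: "M * Q = mat n n (\<lambda>(i, j). M $$ (i, p j))" if "M \<in> carrier_mat n n" for M
  proof (rule eq_matI)
    fix i j assume "i < dim_row (mat n n (\<lambda>(i, j). M $$ (i, p j)))"
      and "j < dim_col (mat n n (\<lambda>(i, j). M $$ (i, p j)))"
    then show "(M * Q) $$ (i, j) = mat n n (\<lambda>(i, j). M $$ (i, p j)) $$ (i, j)"
      using that by (auto simp: Q_def scalar_prod_def if_distrib[of "\<lambda>x. _ * x"] p_less cong: if_cong)
  qed (use that Q in auto)
  have PQ: "P * Q = 1\<^sub>m n"
    unfolding PM[OF Q] by (rule eq_matI) (auto simp: Q_def p_less p_inj)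
  have QP: "Q * P = 1\<^sub>m n"
    using mat_mult_left_right_inverse[OF P Q PQ] .
  have PA: "P * A \<in> carrier_mat n n"
    using P A by simp
  have "adjacency_matrix vs G = P * A * Q"
    unfolding MQ[OF PA] unfolding PM[OF A]
    by (rule eq_matI) (auto simp: adjacency_matrix_def A_def len nth p_less simp flip: n_def)
  moreover have "adjacency_matrix vs G \<in> carrier_mat n n"
    by (simp add: adjacency_matrix_def len)
  ultimately show ?thesis
    using A P Q PQ QP by (intro similar_matI[of _ _ P Q n]) (auto simp: A_def)
qed

lemma adjacency_spectrum_eq:
  assumes "distinct vs" "set vs = pverts G"
  shows "adjacency_spectrum G = proots (char_poly (adjacency_matrix vs G))"
proof -
  define ws where "ws = (SOME ws. distinct ws \<and> set ws = pverts G)"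
  have "distinct ws \<and> set ws = pverts G"
    unfolding ws_def by (rule someI[of _ vs]) (simp add: assms)
  with assms have "similar_mat (adjacency_matrix ws G) (adjacency_matrix vs G)"
    by (intro similar_adjacency_matrix) auto
  then show ?thesis
    unfolding adjacency_spectrum_def ws_def[symmetric] by (simp add: char_poly_similar)
qed

end

theory Submission
  imports Defs "Jordan_Normal_Form.Schur_Decomposition"
begin

text \<open>
  The spectrum determines the number \<open>tr A^k\<close> of closed walks of each length \<open>k\<close>. The adjacency matrix
  of the Petersen graph satisfies \<open>A^2 + A - 2 I = J\<close>, hence \<open>(A - 3 I) (A^2 + A - 2 I) = 0\<close>. For a
  cospectral graph the matrix \<open>C = (A - 3 I) (A^2 + A - 2 I)\<close> is symmetric with \<open>tr C^2 = 0\<close>, so it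
  vanishes too. Then \<open>M = A^2 + A - 2 I\<close> satisfies \<open>M^2 = 10 M\<close>, it is an integer matrix with trace
  10, and its off-diagonal entries are nonnegative; this forces \<open>M = J\<close>. So the graph is 3-regular,
  without triangles, and two distinct nonadjacent vertices have exactly one common neighbour. Starting
  from any vertex, these properties determine all adjacencies.
\<close>

subsection \<open>Closed walks and the spectrum\<close>

lemma trace_mult_commute:
  fixes A B :: "'a :: comm_semiring_0 mat"
  assumes "A \<in> carrier_mat n n" "B \<in> carrier_mat n n"
  shows "(\<Sum>i<n. (A * B) $$ (i, i)) = (\<Sum>i<n. (B * A) $$ (i, i))"
proof -
  have "(\<Sum>i<n. (A * B) $$ (i, i)) = (\<Sum>i<n. \<Sum>j<n. A $$ (i, j) * B $$ (j, i))"
    using assms by (intro sum.cong) (auto simp: scalar_prod_def lessThan_atLeast0)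
  also have "\<dots> = (\<Sum>i<n. \<Sum>j<n. B $$ (i, j) * A $$ (j, i))"
    by (subst sum.swap) (simp add: mult.commute)
  also have "\<dots> = (\<Sum>i<n. (B * A) $$ (i, i))"
    using assms by (intro sum.cong) (auto simp: scalar_prod_def lessThan_atLeast0)
  finally show ?thesis .
qed

text \<open>Only the diagonal is wanted later; the zeros below it are carried along because the
  induction step needs them to kill all terms but \<open>l = i\<close>.\<close>

lemma upper_triangular_pow:
  fixes B :: "'a :: semiring_1 mat"
  assumes "B \<in> carrier_mat n n" "upper_triangular B"
  shows "(\<forall>i<n. (B ^\<^sub>m k) $$ (i, i) = B $$ (i, i) ^ k) \<and> (\<forall>i<n. \<forall>j<i. (B ^\<^sub>m k) $$ (i, j) = 0)"
proof (induction k)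
  case 0
  then show ?case using assms by auto
next
  case (Suc k)
  have C: "B ^\<^sub>m k \<in> carrier_mat n n"
    using assms by simp
  have entry: "(B ^\<^sub>m Suc k) $$ (i, j) = (\<Sum>l<n. (B ^\<^sub>m k) $$ (i, l) * B $$ (l, j))"
    if "i < n" "j < n" for i j
    using assms C that by (auto simp: scalar_prod_def lessThan_atLeast0 intro!: sum.cong)
  have zero: "(B ^\<^sub>m k) $$ (i, l) * B $$ (l, j) = 0" if "i < n" "l < n" "l < i \<or> j < l" for i j l
    using that Suc assms by (auto simp: upper_triangular_def)
  have "(B ^\<^sub>m Suc k) $$ (i, i) = B $$ (i, i) ^ Suc k" if "i < n" for i
  proof -
    have "(B ^\<^sub>m Suc k) $$ (i, i) = (\<Sum>l\<in>{i}. (B ^\<^sub>m k) $$ (i, l) * B $$ (l, i))"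
      unfolding entry[OF that that] using that
      by (intro sum.mono_neutral_right ballI zero) auto
    then show ?thesis
      using Suc that by (simp add: power_commutes)
  qed
  moreover have "(B ^\<^sub>m Suc k) $$ (i, j) = 0" if "i < n" "j < i" for i j
  proof -
    have "l < i \<or> j < l" for l
      using that by linarith
    then show ?thesis
      using that by (subst entry) (auto intro!: sum.neutral zero simp del: mult_eq_0_iff)
  qed
  ultimately show ?case
    by blast
qed

text \<open>By Schur triangularisation, \<open>A\<close> is similar to an upper triangular
  \<open>B\<close> whose diagonal lists the eigenvalues with multiplicity. The trace is invariant
  under similarity, and the diagonal of \<open>B^k\<close> consists of \<open>k\<close>-th
  powers.\<close>

lemma trace_pow_eq_sum_proots:
  fixes A :: "complex mat"
  assumes A: "A \<in> carrier_mat n n"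
  shows "(\<Sum>i<n. (A ^\<^sub>m k) $$ (i, i)) = (\<Sum>x\<in>#proots (char_poly A). x ^ k)"
proof -
  obtain es where es: "char_poly A = (\<Prod>e\<leftarrow>es. [:- e, 1:])"
    using char_poly_factorized[OF A] by blast
  obtain B P Q where "schur_decomposition A es = (B, P, Q)"
    by (metis prod_cases3)
  from schur_decomposition[OF A es this]
  have wit: "similar_mat_wit A B P Q" and ut: "upper_triangular B" and diag: "diag_mat B = es"
    by auto
  note D = similar_mat_witD2[OF A wit]
  have Bk: "B ^\<^sub>m k \<in> carrier_mat n n"
    using D by simp
  \<comment> \<open>This bracketing lets \<open>trace_mult_commute\<close> move \<open>P\<close> to
    the right end, where it cancels against \<open>Q\<close>.\<close>
  have "A ^\<^sub>m k = P * (B ^\<^sub>m k * Q)"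
    using similar_mat_wit_pow_id[OF wit, of k] assoc_mult_mat[of P n n "B ^\<^sub>m k" n Q n] D Bk by simp
  moreover have "B ^\<^sub>m k * Q \<in> carrier_mat n n"
    using D Bk by (intro mult_carrier_mat)
  ultimately have "(\<Sum>i<n. (A ^\<^sub>m k) $$ (i, i)) = (\<Sum>i<n. (B ^\<^sub>m k * Q * P) $$ (i, i))"
    using trace_mult_commute[of P n "B ^\<^sub>m k * Q"] D by metis
  also have "B ^\<^sub>m k * Q * P = B ^\<^sub>m k"
    using assoc_mult_mat[OF Bk, of Q n P n] right_mult_one_mat[OF Bk] D by metis
  also have "(\<Sum>i<n. (B ^\<^sub>m k) $$ (i, i)) = (\<Sum>i<n. B $$ (i, i) ^ k)"
    using upper_triangular_pow[of B n k] D ut by (intro sum.cong) auto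
  also have "\<dots> = (\<Sum>x\<leftarrow>es. x ^ k)"
    using D unfolding diag[symmetric] diag_mat_def
    by (simp add: comp_def interv_sum_list_conv_sum_set_nat lessThan_atLeast0)
  also have "\<dots> = (\<Sum>x\<in>#mset es. x ^ k)"
    by (metis mset_map sum_mset_sum_list)
  also have "mset es = proots (char_poly A)"
    unfolding es by (induction es) (auto simp: proots_mult prod_list_zero_iff image_iff simp del: mult_pCons_left)
  finally show ?thesis .
qed

text \<open>These are the entries of \<open>A^k\<close>, indexed by vertices so that no enumeration
  has to be chosen. Integer values matter later, where a positive entry has to be at least
  1.\<close>

primrec walks :: "'a pair_pre_digraph \<Rightarrow> nat \<Rightarrow> 'a \<Rightarrow> 'a \<Rightarrow> int" where
  "walks G 0 u v = of_bool (u = v)"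
| "walks G (Suc k) u v = (\<Sum>x\<in>pverts G. walks G k u x * of_bool ((x, v) \<in> parcs G))"

lemma sum_walks_eq_sum_spectrum:
  assumes "finite (pverts G)"
  shows "of_int (\<Sum>v\<in>pverts G. walks G k v v) = (\<Sum>x\<in>#adjacency_spectrum G. x ^ k)"
proof -
  obtain vs where vs: "set vs = pverts G" "distinct vs"
    using finite_distinct_list[OF assms] by blast
  define n where "n = length vs"
  have bij: "bij_betw ((!) vs) {..<n} (pverts G)"
    using vs by (simp add: bij_betw_nth n_def)
  define A where "A = adjacency_matrix vs G"
  have A: "A \<in> carrier_mat n n"
    by (simp add: A_def adjacency_matrix_def n_def)
  have pow: "(A ^\<^sub>m k) $$ (i, j) = of_int (walks G k (vs ! i) (vs ! j))" if "i < n" "j < n" for i j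
    using that
  proof (induction k arbitrary: j)
    case 0
    then show ?case using A vs by (auto simp: nth_eq_iff_index_eq n_def)
  next
    case (Suc k)
    have "(A ^\<^sub>m Suc k) $$ (i, j) = (\<Sum>l<n. (A ^\<^sub>m k) $$ (i, l) * A $$ (l, j))"
      using A Suc.prems by (auto simp: scalar_prod_def lessThan_atLeast0 intro!: sum.cong)
    also have "\<dots> = (\<Sum>l<n. of_int (walks G k (vs ! i) (vs ! l) * of_bool ((vs ! l, vs ! j) \<in> parcs G)))"
      using Suc by (intro sum.cong) (auto simp: A_def adjacency_matrix_def n_def)
    also have "\<dots> = of_int (walks G (Suc k) (vs ! i) (vs ! j))"
      unfolding walks.simps of_int_sum by (rule sum.reindex_bij_betw[OF bij])
    finally show ?case .
  qed
  have "of_int (\<Sum>v\<in>pverts G. walks G k v v) = (\<Sum>i<n. of_int (walks G k (vs ! i) (vs ! i)) :: complex)"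
    unfolding of_int_sum by (rule sum.reindex_bij_betw[OF bij, symmetric])
  also have "\<dots> = (\<Sum>i<n. (A ^\<^sub>m k) $$ (i, i))"
    by (simp add: pow)
  also have "\<dots> = (\<Sum>x\<in>#adjacency_spectrum G. x ^ k)"
    using trace_pow_eq_sum_proots[OF A] adjacency_spectrum_eq[OF vs(2,1)] by (simp add: A_def)
  finally show ?thesis .
qed

subsection \<open>Closed walks determine the numbers of common neighbours\<close>

text \<open>The strongly regular graphs with parameters (10, 3, 0, 1), that is, the Moore graphs of
  degree 3 and diameter 2.\<close>

definition moore_3_2 :: "'a pair_pre_digraph \<Rightarrow> bool" where
  "moore_3_2 G \<longleftrightarrow> card (pverts G) = 10 \<and>
     (\<forall>u\<in>pverts G. \<forall>v\<in>pverts G. card {x. (u, x) \<in> parcs G \<and> (x, v) \<in> parcs G} =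
        (if u = v then 3 else if (u, v) \<in> parcs G then 0 else 1))"

context pair_graph
begin

section \<open>Algebra of walk counts in a simple graph\<close>

lemma parcs_sym: "(u, v) \<in> parcs G \<longleftrightarrow> (v, u) \<in> parcs G"
  using pair_sym_arcs by (auto simp: symmetric_def dest: symD)

lemma no_loop: "(v, v) \<notin> parcs G"
  using pair_no_loops by fastforce

lemma walks_add:
  assumes "v \<in> pverts G"
  shows "(\<Sum>x\<in>pverts G. walks G k u x * walks G l x v) = walks G (k + l) u v"
  using assms
proof (induction l arbitrary: v)
  case 0
  then show ?case
    using pair_finite_verts by (simp add: of_bool_def if_distrib[of "\<lambda>x. _ * x"] cong: if_cong)
next
  case (Suc l)
  have "(\<Sum>x\<in>pverts G. walks G k u x * walks G (Suc l) x v) =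
      (\<Sum>y\<in>pverts G. (\<Sum>x\<in>pverts G. walks G k u x * walks G l x y) * of_bool ((y, v) \<in> parcs G))"
    unfolding walks.simps sum_distrib_left sum_distrib_right mult.assoc by (rule sum.swap)
  also have "\<dots> = walks G (k + Suc l) u v"
    using Suc by simp
  finally show ?case .
qed

lemma walks_1:
  assumes "u \<in> pverts G"
  shows "walks G 1 u v = of_bool ((u, v) \<in> parcs G)"
  using pair_finite_verts assms by (simp add: of_bool_def if_distrib[of "\<lambda>x. x * _"] cong: if_cong)

lemma walks_sym:
  assumes "u \<in> pverts G" "v \<in> pverts G"
  shows "walks G k u v = walks G k v u"
  using assms
proof (induction k arbitrary: u v)
  case (Suc k)
  \<comment> \<open>The recursion of \<open>walks\<close> splits off the last step;
    \<open>walks_add\<close> splits off the first one instead, which is the reversed walk.\<close>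
  have "walks G (Suc k) v u = (\<Sum>x\<in>pverts G. walks G 1 v x * walks G k x u)"
    using walks_add[OF Suc.prems(1), of 1 v k] by simp
  also have "\<dots> = walks G (Suc k) u v"
    using Suc parcs_sym by (simp add: walks_1 mult.commute del: One_nat_def)
  finally show ?case by simp
qed auto

lemma walks_2:
  assumes "u \<in> pverts G"
  shows "walks G 2 u v = int (card {x. (u, x) \<in> parcs G \<and> (x, v) \<in> parcs G})"
proof -
  have "walks G 2 u v = (\<Sum>x\<in>pverts G. walks G 1 u x * of_bool ((x, v) \<in> parcs G))"
    by (simp add: numeral_2_eq_2)
  also have "\<dots> = (\<Sum>x\<in>pverts G. of_bool ((u, x) \<in> parcs G \<and> (x, v) \<in> parcs G))"
    using assms by (intro sum.cong) (auto simp: walks_1 simp del: One_nat_def)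
  also have "\<dots> = int (card {x\<in>pverts G. (u, x) \<in> parcs G \<and> (x, v) \<in> parcs G})"
    using pair_finite_verts by (simp add: sum.If_cases Int_def of_bool_def)
  also have "{x\<in>pverts G. (u, x) \<in> parcs G \<and> (x, v) \<in> parcs G} = {x. (u, x) \<in> parcs G \<and> (x, v) \<in> parcs G}"
    using in_arcsD1 by auto
  finally show ?thesis .
qed

text \<open>Entrywise form of \<open>A^2 + A - 2 I = J\<close>: equal, adjacent and nonadjacent
  pairs give the three cases.\<close>

lemma moore_3_2_iff:
  "moore_3_2 G \<longleftrightarrow> card (pverts G) = 10 \<and>
     (\<forall>u\<in>pverts G. \<forall>v\<in>pverts G. walks G 2 u v + walks G 1 u v - 2 * walks G 0 u v = 1)"
proof -
  have "walks G 2 u v + walks G 1 u v - 2 * walks G 0 u v = 1 \<longleftrightarrow>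
      card {x. (u, x) \<in> parcs G \<and> (x, v) \<in> parcs G} =
        (if u = v then 3 else if (u, v) \<in> parcs G then 0 else 1)"
    if "u \<in> pverts G" for u v
    using that by (auto simp: walks_1 walks_2 no_loop simp del: One_nat_def)
  then show ?thesis
    unfolding moore_3_2_def by simp
qed

text \<open>The entries of \<open>(A - 3 I) (A - I) (A + 2 I)\<close> for the adjacency matrix \<open>A\<close>.\<close>

definition cubic :: "'a \<Rightarrow> 'a \<Rightarrow> int" where
  "cubic u v = walks G 3 u v - 2 * walks G 2 u v - 5 * walks G 1 u v + 6 * walks G 0 u v"

text \<open>Since \<open>A\<close> is symmetric, the entrywise inner product of \<open>A^k\<close>
  and \<open>A^l\<close> is the trace of \<open>A^(k + l)\<close>.\<close>

lemma sum_walks_mult: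
  "(\<Sum>u\<in>pverts G. \<Sum>v\<in>pverts G. walks G k u v * walks G l u v) = (\<Sum>v\<in>pverts G. walks G (k + l) v v)"
  by (intro sum.cong refl trans[OF _ walks_add]) (simp_all add: walks_sym)

text \<open>The coefficients are those of \<open>(x^3 - 2 x^2 - 5 x + 6)^2\<close>. The sum of
  squares is thus determined by the spectrum.\<close>

lemma sum_cubic_square:
  defines "cw \<equiv> \<lambda>k. \<Sum>v\<in>pverts G. walks G k v v"
  shows "(\<Sum>u\<in>pverts G. \<Sum>v\<in>pverts G. (cubic u v)\<^sup>2) =
    cw 6 - 4 * cw 5 - 6 * cw 4 + 32 * cw 3 + cw 2 - 60 * cw 1 + 36 * cw 0"
proof -
  have idx: "(3::nat) + 3 = 6" "(3::nat) + 2 = 5" "(3::nat) + 1 = 4" "(2::nat) + 2 = 4"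
      "(2::nat) + 1 = 3" "(1::nat) + 1 = 2"
    by simp_all
  let ?S = "\<lambda>k l. \<Sum>u\<in>pverts G. \<Sum>v\<in>pverts G. walks G k u v * walks G l u v"
  have "(\<Sum>u\<in>pverts G. \<Sum>v\<in>pverts G. (cubic u v)\<^sup>2) =
      ?S 3 3 - 4 * ?S 3 2 - 10 * ?S 3 1 + 4 * ?S 2 2 + 12 * ?S 3 0 + 20 * ?S 2 1
      - 24 * ?S 2 0 + 25 * ?S 1 1 - 60 * ?S 1 0 + 36 * ?S 0 0"
    unfolding cubic_def sum_distrib_left sum.distrib[symmetric] sum_subtractf[symmetric]
    by (intro sum.cong refl) (simp add: power2_eq_square algebra_simps)
  then show ?thesis
    unfolding sum_walks_mult cw_def idx add_0_right by simp
qed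

text \<open>The last claim holds because \<open>A^2 + A - 2 I = J\<close> and, by 3-regularity,
  \<open>A J = 3 J\<close>.\<close>

lemma moore_3_2_closed_walks:
  assumes "moore_3_2 G"
  shows "(\<Sum>v\<in>pverts G. walks G 0 v v) = 10" "(\<Sum>v\<in>pverts G. walks G 2 v v) = 30"
    and "(\<Sum>u\<in>pverts G. \<Sum>v\<in>pverts G. (cubic u v)\<^sup>2) = 0"
proof -
  have card: "card (pverts G) = 10"
    and M: "\<And>u v. u \<in> pverts G \<Longrightarrow> v \<in> pverts G \<Longrightarrow> walks G 2 u v + walks G 1 u v - 2 * walks G 0 u v = 1"
    using assms by (auto simp: moore_3_2_iff)
  show "(\<Sum>v\<in>pverts G. walks G 0 v v) = 10"
    using card by simp
  have deg: "walks G 2 v v = 3" if "v \<in> pverts G" for v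
    using M[OF that that] that by (simp add: walks_1 no_loop del: One_nat_def)
  show "(\<Sum>v\<in>pverts G. walks G 2 v v) = 30"
    using card by (simp add: deg)
  have "cubic u v = 0" if u: "u \<in> pverts G" and v: "v \<in> pverts G" for u v
  proof -
    \<comment> \<open>Entries of \<open>A\<close> are 0 or 1 and symmetric, so a row sum of
      \<open>A\<close> equals a diagonal entry of \<open>A^2\<close>.\<close>
    have "walks G 1 u x * walks G 1 x u = walks G 1 u x" if "x \<in> pverts G" for x
      using that u parcs_sym[of x u] by (simp add: walks_1 del: One_nat_def)
    then have "(\<Sum>x\<in>pverts G. walks G 1 u x) = (\<Sum>x\<in>pverts G. walks G 1 u x * walks G 1 x u)"
      by (intro sum.cong) simp_all
    also have "\<dots> = walks G (1 + 1) u u"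
      by (rule walks_add[OF u])
    finally have "(\<Sum>x\<in>pverts G. walks G 1 u x) = walks G (1 + 1) u u" .
    then have "(\<Sum>x\<in>pverts G. walks G 1 u x) = 3"
      using deg[OF u] by (simp add: numeral_2_eq_2)
    \<comment> \<open>Each summand is multiplied by an entry of \<open>J\<close>, which equals 1,
      written as an entry of \<open>A^2 + A - 2 I\<close>.\<close>
    moreover have "(\<Sum>x\<in>pverts G. walks G 1 u x) =
        (\<Sum>x\<in>pverts G. walks G 1 u x * (walks G 2 x v + walks G 1 x v - 2 * walks G 0 x v))"
      using M v by simp
    also have "\<dots> = (\<Sum>x\<in>pverts G. walks G 1 u x * walks G 2 x v)
        + (\<Sum>x\<in>pverts G. walks G 1 u x * walks G 1 x v) - 2 * (\<Sum>x\<in>pverts G. walks G 1 u x * walks G 0 x v)"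
      by (simp add: sum.distrib sum_subtractf sum_distrib_left algebra_simps del: walks.simps One_nat_def)
    also have "\<dots> = walks G 3 u v + walks G 2 u v - 2 * walks G 1 u v"
      unfolding walks_add[OF v] by (simp add: numeral_2_eq_2 numeral_3_eq_3 del: walks.simps)
    ultimately show ?thesis
      using M[OF u v] by (simp add: cubic_def del: walks.simps One_nat_def)
  qed
  then show "(\<Sum>u\<in>pverts G. \<Sum>v\<in>pverts G. (cubic u v)\<^sup>2) = 0"
    by simp
qed

text \<open>From \<open>M^2 = 10 M\<close> and symmetry, the rows of \<open>M\<close> have squared
  norm \<open>10 * M u u\<close>. The diagonal is shown to be 1, then all entries lie between 0 and
  1, and a row of ten such entries with squared norm 10 is constantly 1.\<close>

lemma moore_3_2I:
  assumes w0: "(\<Sum>v\<in>pverts G. walks G 0 v v) = 10"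
    and w2: "(\<Sum>v\<in>pverts G. walks G 2 v v) = 30"
    and cubic: "(\<Sum>u\<in>pverts G. \<Sum>v\<in>pverts G. (cubic u v)\<^sup>2) = 0"
  shows "moore_3_2 G"
proof -
  define M where "M u v = walks G 2 u v + walks G 1 u v - 2 * walks G 0 u v" for u v
  note fin = pair_finite_verts
  note [simp del] = walks.simps One_nat_def
  have card: "card (pverts G) = 10"
    using w0 by (simp add: walks.simps)
  have "\<forall>u\<in>pverts G. (\<Sum>v\<in>pverts G. (cubic u v)\<^sup>2) = 0"
    using cubic fin by (subst (asm) sum_nonneg_eq_0_iff) (auto intro: sum_nonneg)
  then have cubic_0: "cubic u v = 0" if "u \<in> pverts G" "v \<in> pverts G" for u v
    using that fin by (auto simp: sum_nonneg_eq_0_iff)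
  then have walks_3: "walks G 3 u v = 2 * walks G 2 u v + 5 * walks G 1 u v - 6 * walks G 0 u v"
    if "u \<in> pverts G" "v \<in> pverts G" for u v
    using that by (fastforce simp: cubic_def)
  \<comment> \<open>The cubic relation multiplied by \<open>A\<close>.\<close>
  have walks_4: "walks G 4 u v = 2 * walks G 3 u v + 5 * walks G 2 u v - 6 * walks G 1 u v"
    if u: "u \<in> pverts G" and v: "v \<in> pverts G" for u v
  proof -
    have "walks G (1 + 3) u v = (\<Sum>x\<in>pverts G. walks G 1 u x *
        (2 * walks G 2 x v + 5 * walks G 1 x v - 6 * walks G 0 x v))"
      unfolding walks_add[OF v, symmetric] using v walks_3 by simp
    also have "\<dots> = 2 * (\<Sum>x\<in>pverts G. walks G 1 u x * walks G 2 x v)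
        + 5 * (\<Sum>x\<in>pverts G. walks G 1 u x * walks G 1 x v) - 6 * (\<Sum>x\<in>pverts G. walks G 1 u x * walks G 0 x v)"
      by (simp add: sum.distrib sum_subtractf sum_distrib_left algebra_simps)
    finally show ?thesis
      unfolding walks_add[OF v] by simp
  qed
  have M_sym: "M u v = M v u" if "u \<in> pverts G" "v \<in> pverts G" for u v
    using that by (simp add: M_def walks_sym)
  \<comment> \<open>With \<open>m = x^2 + x - 2\<close>, the polynomial
    \<open>m^2 - 10 m = m (x - 3) (x + 4)\<close> is a multiple of the cubic. By symmetry of
    \<open>M\<close>, the product is stated as an inner product of rows.\<close>
  have MM: "(\<Sum>x\<in>pverts G. M u x * M v x) = 10 * M u v"
    if u: "u \<in> pverts G" and v: "v \<in> pverts G" for u v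
  proof -
    have idx: "(2::nat) + 2 = 4" "(2::nat) + 1 = 3" "(1::nat) + 2 = 3" "(1::nat) + 1 = 2"
      by simp_all
    let ?S = "\<lambda>k l. \<Sum>x\<in>pverts G. walks G k u x * walks G l x v"
    have "(\<Sum>x\<in>pverts G. M u x * M v x) = (\<Sum>x\<in>pverts G. M u x * M x v)"
      using v M_sym by simp
    also have "\<dots> = ?S 2 2 + ?S 2 1 - 2 * ?S 2 0 + ?S 1 2 + ?S 1 1 - 2 * ?S 1 0
        - 2 * ?S 0 2 - 2 * ?S 0 1 + 4 * ?S 0 0"
      unfolding M_def sum_distrib_left sum.distrib[symmetric] sum_subtractf[symmetric]
      by (intro sum.cong refl) (simp add: algebra_simps)
    also have "\<dots> = 10 * M u v"
      unfolding walks_add[OF v] idx add_0 add_0_right using walks_3[OF u v] walks_4[OF u v]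
      by (simp add: M_def)
    finally show ?thesis .
  qed
  have M_diag: "M u u = walks G 2 u u - 2" if "u \<in> pverts G" for u
    using that by (simp add: M_def walks_1 walks.simps no_loop)
  have M_ge: "M u v \<ge> walks G 1 u v" "walks G 1 u v \<ge> 0"
    if "u \<in> pverts G" "v \<in> pverts G" "u \<noteq> v" for u v
    using that by (auto simp: M_def walks_1 walks_2 walks.simps)
  \<comment> \<open>Otherwise row \<open>u\<close> of \<open>M\<close> vanishes, so \<open>u\<close>
    has no neighbour; but then \<open>M u u\<close> would be -2.\<close>
  have M_diag_pos: "M u u > 0" if u: "u \<in> pverts G" for u
  proof (rule ccontr)
    assume "\<not> M u u > 0"
    moreover have "(\<Sum>x\<in>pverts G. M u x * M u x) \<ge> 0"
      by (intro sum_nonneg) simp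
    ultimately have "M u u = 0"
      using MM[OF u u] by simp
    then have "(\<Sum>x\<in>pverts G. M u x * M u x) = 0"
      using MM[OF u u] by simp
    then have "\<forall>x\<in>pverts G. M u x = 0"
      using fin by (subst (asm) sum_nonneg_eq_0_iff) auto
    moreover have "walks G 1 u u = 0"
      using u by (simp add: walks_1 no_loop)
    ultimately have "walks G 1 u x = 0" if "x \<in> pverts G" for x
      using that M_ge[OF u that] by force
    then have "walks G (1 + 1) u u = 0"
      unfolding walks_add[OF u, symmetric] by simp
    then show False
      using M_diag[OF u] \<open>M u u = 0\<close> by simp
  qed
  \<comment> \<open>The trace of \<open>M\<close> is 30 - 20 = 10, and each of the ten diagonal
    entries is a positive integer, so each is 1.\<close>
  have "(\<Sum>u\<in>pverts G. M u u - 1) = 0"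
    using w2 card by (simp add: M_diag sum_subtractf)
  then have M_diag_1: "M u u = 1" if "u \<in> pverts G" for u
    using sum_nonneg_0[OF fin, of "\<lambda>u. M u u - 1" u] M_diag_pos that by simp
  have M_le: "M u v \<le> 1" if u: "u \<in> pverts G" and v: "v \<in> pverts G" for u v
  proof -
    \<comment> \<open>The squared distance between rows \<open>u\<close> and \<open>v\<close>, as in
      the Cauchy-Schwarz inequality.\<close>
    have "0 \<le> (\<Sum>x\<in>pverts G. (M u x - M v x)\<^sup>2)"
      by (intro sum_nonneg) simp
    also have "\<dots> = (\<Sum>x\<in>pverts G. M u x * M u x) + (\<Sum>x\<in>pverts G. M v x * M v x)
        - 2 * (\<Sum>x\<in>pverts G. M u x * M v x)"
      unfolding sum_distrib_left sum.distrib[symmetric] sum_subtractf[symmetric]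
      by (intro sum.cong refl) (simp add: power2_eq_square algebra_simps)
    also have "\<dots> = 20 - 20 * M u v"
      using u v by (simp add: MM M_diag_1)
    finally show ?thesis by simp
  qed
  have M_nonneg: "M u v \<ge> 0" if "u \<in> pverts G" "v \<in> pverts G" for u v
    using that M_ge[of u v] M_diag_1[of u] by (cases "u = v") auto
  have "M u v = 1" if u: "u \<in> pverts G" and v: "v \<in> pverts G" for u v
  proof -
    have "(\<Sum>x\<in>pverts G. 1 - M u x * M u x) = 0"
      using card MM[OF u u] M_diag_1[OF u] by (simp add: sum_subtractf)
    moreover have "1 - M u x * M u x \<ge> 0" if "x \<in> pverts G" for x
      using M_le[OF u that] M_nonneg[OF u that] mult_le_one[of "M u x" "M u x"] by simp
    ultimately have "M u v * M u v = 1"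
      using v fin by (subst (asm) sum_nonneg_eq_0_iff) auto
    then show ?thesis
      using M_nonneg[OF u v] zmult_eq_1_iff by force
  qed
  then show ?thesis
    using card by (simp add: moore_3_2_iff M_def)
qed

end

lemma moore_3_2_if_cospectral:
  assumes "pair_graph G" "pair_graph H" "adjacency_spectrum G = adjacency_spectrum H" "moore_3_2 H"
  shows "moore_3_2 G"
proof -
  interpret G: pair_graph G by fact
  interpret H: pair_graph H by fact
  have eq: "(\<Sum>v\<in>pverts G. walks G k v v) = (\<Sum>v\<in>pverts H. walks H k v v)" for k
    using sum_walks_eq_sum_spectrum[OF G.pair_finite_verts, of k]
      sum_walks_eq_sum_spectrum[OF H.pair_finite_verts, of k] assms(3)
    by (metis of_int_eq_iff)
  show ?thesis
    \<comment> \<open>The three facts about \<open>H\<close> involve only closed walk counts, so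
      they can be rewritten into facts about \<open>G\<close>.\<close>
    using H.moore_3_2_closed_walks[OF assms(4)]
    unfolding H.sum_cubic_square eq[symmetric] G.sum_cubic_square[symmetric]
    by (rule G.moore_3_2I)
qed

subsection \<open>Uniqueness\<close>

lemma card_3_memberE:
  assumes "card A = 3" "x \<in> A"
  obtains y z where "A = {x, y, z}" "x \<noteq> y" "x \<noteq> z" "y \<noteq> z"
  using assms unfolding card_3_iff by auto

text \<open>
  Vertex 0 is the root, 1, 2, 3 are its neighbours, and the pairs (4, 5), (6, 7), (8, 9) are the
  remaining neighbours of 1, 2, 3.
\<close>

definition petersen_nbrs :: "nat list list" where
  "petersen_nbrs = [[1,2,3], [0,4,5], [0,6,7], [0,8,9], [1,6,8], [1,7,9], [2,4,9], [2,5,8], [3,4,7], [3,5,6]]"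

text \<open>Explore the graph from a root \<open>x\<close>. Triangles and 4-cycles are excluded, and
  nonadjacent vertices have a common neighbour. Once the children of \<open>a1\<close> and
  \<open>a2\<close> are named by adjacency to \<open>b\<close>, every other adjacency is
  forced.\<close>

lemma (in pair_graph) moore_3_2_enumeration:
  assumes "moore_3_2 G"
  obtains vs where "length vs = 10" "distinct vs" "set vs = pverts G"
    "\<And>i j. i < 10 \<Longrightarrow> j < 10 \<Longrightarrow> (vs ! i, vs ! j) \<in> parcs G \<longleftrightarrow> j \<in> set (petersen_nbrs ! i)"
proof -
  define N where "N u = {v. (u, v) \<in> parcs G}" for u
  have N_sub: "N u \<subseteq> pverts G" for u
    using in_arcsD2 by (auto simp: N_def)
  have N_sym: "v \<in> N u \<longleftrightarrow> u \<in> N v" for u v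
    using parcs_sym by (simp add: N_def)
  have N_irrefl: "u \<notin> N u" for u
    by (simp add: N_def no_loop)
  have card: "card (pverts G) = 10"
    and common: "\<And>u v. u \<in> pverts G \<Longrightarrow> v \<in> pverts G \<Longrightarrow>
      card (N u \<inter> N v) = (if u = v then 3 else if v \<in> N u then 0 else 1)"
    using assms parcs_sym unfolding moore_3_2_def N_def by (auto simp: Int_def)
  have card_N: "card (N u) = 3" if "u \<in> pverts G" for u
    using common[OF that that] by simp
  have no_triangle: False if "v \<in> N u" "w \<in> N u" "w \<in> N v" for u v w
  proof -
    have uv: "u \<in> pverts G" "v \<in> pverts G"
      using that N_sub N_sym by blast+
    have "u \<noteq> v"
      using that N_irrefl by auto
    then have "card (N u \<inter> N v) = 0"
      using common[OF uv] that by simp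
    moreover have "finite (N u \<inter> N v)"
      using N_sub pair_finite_verts by (meson finite_Int finite_subset)
    ultimately show False
      using that by auto
  qed
  have no_square: "x = y" if "x \<in> N u" "x \<in> N v" "y \<in> N u" "y \<in> N v" "u \<noteq> v" for u v x y
  proof -
    have "u \<in> pverts G" "v \<in> pverts G"
      using that N_sub N_sym by blast+
    moreover have "v \<notin> N u"
      using no_triangle that N_sym by blast
    ultimately have "card (N u \<inter> N v) = 1"
      using common that by simp
    then show ?thesis
      using that by (metis IntI card_1_singletonE singletonD)
  qed
  have common_nbr: "\<exists>x. x \<in> N u \<and> x \<in> N v"
    if "u \<in> pverts G" "v \<in> pverts G" "u \<noteq> v" "v \<notin> N u" for u v
  proof -
    have "card (N u \<inter> N v) = 1"
      using that common by simp
    then show ?thesis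
      by (metis Int_iff card_1_singletonE insertI1)
  qed
  \<comment> \<open>Among the neighbours of \<open>a\<close> other than \<open>x\<close>, exactly
    one is adjacent to \<open>u\<close>; \<open>p\<close> names that one and \<open>q\<close> the
    other.\<close>
  have obtain_split: thesis
    if prem: "u \<in> pverts G" "a \<in> N x" "u \<noteq> a" "u \<notin> N a" "u \<notin> N x"
      and concl: "\<And>p q. N a = {x, p, q} \<Longrightarrow> x \<noteq> p \<Longrightarrow> x \<noteq> q \<Longrightarrow> p \<noteq> q \<Longrightarrow> p \<in> N u \<Longrightarrow> q \<notin> N u \<Longrightarrow> thesis"
    for u a x thesis
  proof -
    have a: "a \<in> pverts G"
      using prem N_sub by blast
    obtain p where p: "p \<in> N u" "p \<in> N a"
      using common_nbr[of u a] prem(1,3,4) a N_sym[of a u] by blast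
    obtain q r where qr: "N a = {p, q, r}" "p \<noteq> q" "p \<noteq> r" "q \<noteq> r"
      using card_3_memberE[OF card_N[OF a] p(2)] by blast
    have "x \<in> N a" "x \<noteq> p"
      using prem p N_sym by blast+
    moreover have "y \<notin> N u" if "y \<in> N a" "y \<noteq> p" for y
      using no_square[of y u a p] p that \<open>u \<noteq> a\<close> by blast
    ultimately show thesis
      using concl[of p q] concl[of p r] qr p by (auto simp: insert_commute)
  qed
  have N_eq: "N u = {x, y, z}"
    if "u \<in> pverts G" "x \<in> N u" "y \<in> N u" "z \<in> N u" "x \<noteq> y" "x \<noteq> z" "y \<noteq> z" for u x y z
  proof (rule card_subset_eq[symmetric])
    show "finite (N u)"
      using N_sub pair_finite_verts by (rule finite_subset)
  qed (use that card_N in auto)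
  obtain x where x: "x \<in> pverts G"
    using card by fastforce
  obtain a0 a1 a2 where Nx: "N x = {a0, a1, a2}" and a_neq: "a0 \<noteq> a1" "a0 \<noteq> a2" "a1 \<noteq> a2"
    using card_N[OF x] by (auto simp: card_3_iff)
  have aV: "a0 \<in> pverts G" "a1 \<in> pverts G" "a2 \<in> pverts G"
    using Nx N_sub by blast+
  have "x \<in> N a0"
    using Nx N_sym by blast
  then obtain b b' where Na0: "N a0 = {x, b, b'}" and b_neq: "x \<noteq> b" "x \<noteq> b'" "b \<noteq> b'"
    using card_3_memberE[OF card_N[OF aV(1)]] by metis
  have bV: "b \<in> pverts G" "b' \<in> pverts G"
    using Na0 N_sub by blast+
  \<comment> \<open>A child \<open>u\<close> of one neighbour \<open>a'\<close> of the root is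
    neither equal nor adjacent to another neighbour \<open>a\<close>, and is not adjacent to the
    root.\<close>
  have far: "u \<noteq> a \<and> u \<notin> N a \<and> u \<notin> N x"
    if "u \<in> N a'" "u \<noteq> x" "a \<in> N x" "a' \<in> N x" "a \<noteq> a'" for u a a'
    using that no_triangle[of a' x u] no_triangle[of a x a'] no_square[of u a a' x] N_sym by blast
  obtain p q where Na1: "N a1 = {x, p, q}" and p_neq: "x \<noteq> p" "x \<noteq> q" "p \<noteq> q" and pq: "p \<in> N b" "q \<notin> N b"
    using obtain_split[of b a1 x] far[of b a0 a1] bV a_neq b_neq Na0 Nx by auto
  obtain r s where Na2: "N a2 = {x, r, s}" and r_neq: "x \<noteq> r" "x \<noteq> s" "r \<noteq> s" and rs: "r \<in> N b" "s \<notin> N b"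
    using obtain_split[of b a2 x] far[of b a0 a2] bV a_neq b_neq Na0 Nx by auto
  have pV: "p \<in> pverts G" "q \<in> pverts G" "r \<in> pverts G" "s \<in> pverts G"
    using Na1 Na2 N_sub by blast+
  \<comment> \<open>The same dichotomy as \<open>obtain_split\<close>, for children that already
    have names.\<close>
  have split: "p' \<in> N u \<and> q' \<notin> N u \<or> p' \<notin> N u \<and> q' \<in> N u"
    if "u \<in> pverts G" "u \<in> N a'" "u \<noteq> x" "a \<in> N x" "a' \<in> N x" "a \<noteq> a'" "N a = {x, p', q'}" for u a a' p' q'
    using obtain_split[of u a x] far[of u a' a] that by (metis doubleton_eq_iff insert_iff singletonD)
  let ?vs = "[x, a0, a1, a2, b, b', p, q, r, s]"
  have "a0 \<in> N b" "a0 \<in> N b'"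
    using Na0 N_sym by blast+
  moreover have "p \<noteq> a0" "r \<noteq> a0"
    using far[of p a1 a0] far[of r a2 a0] Na1 Na2 Nx a_neq p_neq r_neq by auto
  \<comment> \<open>\<open>b\<close> and \<open>b'\<close> already share \<open>a0\<close>, so a
    second common neighbour would close a 4-cycle.\<close>
  ultimately have b'p: "p \<notin> N b'" and b'r: "r \<notin> N b'"
    using no_square[of p b b' a0] no_square[of r b b' a0] pq rs b_neq by blast+
  have b'q: "q \<in> N b'" and b's: "s \<in> N b'"
    using split[of b' a0 a1 p q] split[of b' a0 a2 r s] b'p b'r bV b_neq Na0 Na1 Na2 Nx a_neq by auto
  \<comment> \<open>Both are neighbours of \<open>b\<close>, so an edge between them would close a
    triangle; likewise below for \<open>q\<close>, \<open>s\<close> and \<open>b'\<close>.\<close>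
  have "r \<notin> N p"
    using no_triangle pq rs by blast
  then have ps: "s \<in> N p"
    using split[of p a1 a2 r s] pV p_neq Na1 Na2 Nx a_neq by auto
  have "s \<notin> N q"
    using no_triangle b'q b's by blast
  then have qr: "r \<in> N q"
    using split[of q a1 a2 r s] pV p_neq Na1 Na2 Nx a_neq by auto
  have a_not: "a0 \<noteq> x" "a1 \<noteq> x" "a2 \<noteq> x"
    using Nx N_irrefl by blast+
  have dist: "distinct ?vs"
    using a_neq a_not b_neq p_neq r_neq Nx Na0 Na1 Na2
      far[of b a0 a1] far[of b a0 a2] far[of b' a0 a1] far[of b' a0 a2]
      far[of p a1 a0] far[of p a1 a2] far[of q a1 a0] far[of q a1 a2]
      far[of r a2 a0] far[of r a2 a1] far[of s a2 a0] far[of s a2 a1]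
      N_irrefl[of a0] N_irrefl[of a1] N_irrefl[of a2]
    by simp metis
  have verts: "set ?vs = pverts G"
  proof (rule card_subset_eq[OF pair_finite_verts])
    show "set ?vs \<subseteq> pverts G"
      using x aV bV pV by simp
    show "card (set ?vs) = card (pverts G)"
      unfolding distinct_card[OF dist] card by simp
  qed
  \<comment> \<open>Three distinct neighbours are known for each of these vertices, and the degree
    is 3.\<close>
  have Nb: "N b = {a0, p, r}" "N b' = {a0, q, s}" "N p = {a1, b, s}" "N q = {a1, b', r}"
    "N r = {a2, b, q}" "N s = {a2, b', p}"
    using Na0 Na1 Na2 pq rs b'q b's ps qr dist bV pV N_sym by (intro N_eq; force)+
  have "(?vs ! i, ?vs ! j) \<in> parcs G \<longleftrightarrow> j \<in> set (petersen_nbrs ! i)" if "i < 10" "j < 10" for i j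
  proof -
    have idx: "i \<in> {0,1,2,3,4,5,6,7,8,9}" "j \<in> {0,1,2,3,4,5,6,7,8,9}"
      using that by auto
    have "?vs ! j \<in> N (?vs ! i) \<longleftrightarrow> j \<in> set (petersen_nbrs ! i)"
      using idx dist by (auto simp: petersen_nbrs_def Nx Na0 Na1 Na2 Nb)
    then show ?thesis
      by (simp add: N_def)
  qed
  with that[of ?vs] dist verts show thesis
    by simp
qed

section \<open>Isomorphisms from matching vertex enumerations\<close>

lemma (in pair_graph) digraph_isoI_nth:
  assumes H: "pair_graph H"
    and vs: "distinct vs" "set vs = pverts G" and ws: "distinct ws" "set ws = pverts H"
    and len: "length vs = length ws"
    and arcs: "\<And>i j. i < length vs \<Longrightarrow> j < length vs \<Longrightarrow> (vs ! i, vs ! j) \<in> parcs G \<longleftrightarrow> (ws ! i, ws ! j) \<in> parcs H"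
  shows "digraph_iso (with_proj G) (with_proj H)"
proof -
  interpret H: pair_graph H by fact
  define f where "f u = ws ! (THE i. i < length vs \<and> vs ! i = u)" for u
  have f_nth: "f (vs ! i) = ws ! i" if "i < length vs" for i
  proof -
    have "(THE j. j < length vs \<and> vs ! j = vs ! i) = i"
      using that vs by (auto simp: nth_eq_iff_index_eq)
    then show ?thesis
      by (simp add: f_def)
  qed
  have V: "pverts G = (!) vs ` {..<length vs}" "pverts H = (!) ws ` {..<length vs}"
    using bij_betw_imp_surj_on[OF bij_betw_nth[OF vs(1) refl refl]]
      bij_betw_imp_surj_on[OF bij_betw_nth[OF ws(1) refl refl]] vs(2) ws(2) len by simp_all
  have inj: "inj_on f (pverts G)"
    using ws len unfolding V(1) by (auto simp: inj_on_def f_nth nth_eq_iff_index_eq)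
  have fV: "f ` pverts G = pverts H"
    unfolding V image_image by (simp add: f_nth)
  have f_arcs: "(u, v) \<in> parcs G \<longleftrightarrow> (f u, f v) \<in> parcs H" if "u \<in> pverts G" "v \<in> pverts G" for u v
    using that arcs unfolding V(1) by (auto simp: f_nth)
  have sub: "parcs G \<subseteq> pverts G \<times> pverts G" "parcs H \<subseteq> pverts H \<times> pverts H"
    by (auto dest: in_arcsD1 in_arcsD2 H.in_arcsD1 H.in_arcsD2)
  have fE: "map_prod f f ` parcs G = parcs H"
  proof (intro equalityI subsetI)
    fix e assume "e \<in> map_prod f f ` parcs G"
    then obtain u v where "e = (f u, f v)" "(u, v) \<in> parcs G"
      by auto
    then show "e \<in> parcs H"
      using f_arcs sub(1) by blast
  next
    fix e assume e: "e \<in> parcs H"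
    then obtain u v where "e = (f u, f v)" "u \<in> pverts G" "v \<in> pverts G"
      using sub(2) unfolding fV[symmetric] by blast
    with e show "e \<in> map_prod f f ` parcs G"
      using f_arcs by auto
  qed
  \<comment> \<open>\<open>app_iso\<close> takes the head and tail maps of the image from this
    record, so the projections are what makes the image equal to \<open>with_proj H\<close>.\<close>
  let ?h = "\<lparr>iso_verts = f, iso_arcs = map_prod f f, iso_head = snd, iso_tail = fst\<rparr>"
  have "inj_on (map_prod f f) (parcs G)"
    using map_prod_inj_on[OF inj inj] sub(1) by (rule inj_on_subset)
  then have "digraph_isomorphism ?h"
    using inj wf_digraph_axioms by (auto simp: digraph_isomorphism_def)
  moreover have "with_proj H = app_iso ?h (with_proj G)"
    by (simp add: app_iso_def fV fE with_proj_def)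
  ultimately show ?thesis
    unfolding digraph_iso_def by blast
qed

subsection \<open>The Petersen graph\<close>

lemma graph_edges_complete_graph:
  "graph_edges (complete_graph V) = (\<Union>u\<in>V. (\<lambda>v. {u, v}) ` (V - {u}))"
  by (auto simp: graph_edges_def complete_graph_def)

lemma pverts_petersen_graph:
  "pverts petersen_graph = {{0,1},{0,2},{0,3},{0,4},{1,2},{1,3},{1,4},{2,3},{2,4},{3,4}}"
proof -
  have five: "{..<5} = {0,1,2,3,4::nat}"
    by auto
  have "pverts petersen_graph = graph_edges (complete_graph {..<5})"
    by (simp add: petersen_graph_def complement_graph_def line_graph_def)
  then show ?thesis
    unfolding graph_edges_complete_graph five by (simp add: insert_Diff_if insert_commute)
qed

text \<open>The description as a Kneser graph: 2-subsets of a 5-set, adjacent when disjoint.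
  Disjoint edges are automatically distinct because edges are nonempty.\<close>

lemma parcs_petersen_graph:
  "(e, f) \<in> parcs petersen_graph \<longleftrightarrow> e \<in> pverts petersen_graph \<and> f \<in> pverts petersen_graph \<and> e \<inter> f = {}"
proof -
  have "{} \<notin> graph_edges (complete_graph {..<5::nat})"
    by (auto simp: graph_edges_def)
  then show ?thesis
    unfolding petersen_graph_def complement_graph_def line_graph_def by auto
qed

lemma moore_3_2_petersen_graph: "moore_3_2 petersen_graph"
proof -
  define vs :: "nat set list" where
    "vs = [{0,1},{0,2},{0,3},{0,4},{1,2},{1,3},{1,4},{2,3},{2,4},{3,4}]"
  have V: "pverts petersen_graph = set vs"
    by (simp add: pverts_petersen_graph vs_def)
  have "distinct vs"
    by (simp add: vs_def doubleton_eq_iff)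
  \<comment> \<open>Counting with a list filter makes the check of all 100 pairs executable.\<close>
  have common: "card {x. (u, x) \<in> parcs petersen_graph \<and> (x, v) \<in> parcs petersen_graph} =
      length (filter (\<lambda>x. u \<inter> x = {} \<and> x \<inter> v = {}) vs)"
    if "u \<in> set vs" "v \<in> set vs" for u v
  proof -
    have "{x. (u, x) \<in> parcs petersen_graph \<and> (x, v) \<in> parcs petersen_graph} =
        set (filter (\<lambda>x. u \<inter> x = {} \<and> x \<inter> v = {}) vs)"
      using that by (auto simp: parcs_petersen_graph V)
    then show ?thesis
      using \<open>distinct vs\<close> by (simp add: distinct_card del: set_filter)
  qed
  have table: "\<forall>u\<in>set vs. \<forall>v\<in>set vs. length (filter (\<lambda>x. u \<inter> x = {} \<and> x \<inter> v = {}) vs) =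
      (if u = v then 3 else if u \<inter> v = {} then 0 else 1)"
    unfolding vs_def by code_simp
  have "card (set vs) = 10"
    unfolding distinct_card[OF \<open>distinct vs\<close>] by (simp add: vs_def)
  moreover have "(u, v) \<in> parcs petersen_graph \<longleftrightarrow> u \<inter> v = {}" if "u \<in> set vs" "v \<in> set vs" for u v
    using that by (simp add: parcs_petersen_graph V)
  ultimately show ?thesis
    using table unfolding moore_3_2_def V by (auto simp only: common)
qed

theorem corollary2p4p32:
  fixes G :: "'a pair_pre_digraph"
  assumes "pair_graph G"
    and "adjacency_spectrum G = adjacency_spectrum petersen_graph"
  shows "digraph_iso (with_proj G) (with_proj petersen_graph)"
proof -
  interpret G: pair_graph G by fact
  interpret P: pair_graph petersen_graph by (rule pair_graph_petersen_graph)
  have "moore_3_2 G"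
    using moore_3_2_if_cospectral[OF assms(1) pair_graph_petersen_graph assms(2) moore_3_2_petersen_graph] .
  then obtain vs where vs: "length vs = 10" "distinct vs" "set vs = pverts G"
    "\<And>i j. i < 10 \<Longrightarrow> j < 10 \<Longrightarrow> (vs ! i, vs ! j) \<in> parcs G \<longleftrightarrow> j \<in> set (petersen_nbrs ! i)"
    using G.moore_3_2_enumeration by blast
  \<comment> \<open>The Petersen graph itself is enumerated against the same table, so equal
    positions in \<open>vs\<close> and \<open>ws\<close> correspond.\<close>
  obtain ws where ws: "length ws = 10" "distinct ws" "set ws = pverts petersen_graph"
    "\<And>i j. i < 10 \<Longrightarrow> j < 10 \<Longrightarrow> (ws ! i, ws ! j) \<in> parcs petersen_graph \<longleftrightarrow> j \<in> set (petersen_nbrs ! i)"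
    using P.moore_3_2_enumeration[OF moore_3_2_petersen_graph] by blast
  show ?thesis
    by (rule G.digraph_isoI_nth[OF pair_graph_petersen_graph vs(2,3) ws(2,3)])
      (simp_all add: vs(1,4) ws(1,4))
qed

end
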